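(* Let $\ell\ge 2$, $m\ge 1$ and $2\le r\le \ell$ be integers, let $V=\mathbb{Z}_\ell^m$, and let $\mathcal{H}_r=(V,\mathcal{E})$ be the hyperlattice with hyperedges of size $r$, i.e. the hypergraph whose hyperedges are all contiguous $r$-node (cyclic) windows along each coordinate direction. Let $A_{\mathrm{cl}}$ be its clique adjacency matrix, and let $L_{\mathrm{cl}}=mr(r-1)I-A_{\mathrm{cl}}$ and $L_h=mrI-\frac{1}{r-1}A_{\mathrm{cl}}$ be its clique Laplacian and hyperedge-based Laplacian. Then: (1) $A_{\mathrm{cl}}$ is block-circulant and is diagonalized by the Fourier basis $$\varphi_k(x)=\exp\!\left(\frac{2\pi \mathrm{i}}{\ell}\langle k,x\rangle\right),\qquad k=(k_1,\dots,k_m)\in\mathbb{Z}_\ell^m,$$ where $\langle k,x\rangle=\sum_{j=1}^m k_jx_j$. For each $k$, the eigenvalue of $A_{\mathrm{cl}}$ on $\varphi_k$ is $$\alpha(k)=\sum_{j=1}^m\alpha_{1D}(k_j),\qquad \alpha_{1D}(k_j)=2\sum_{d=1}^{r-1}(r-d)\cos\!\left(\frac{2\pi k_j d}{\ell}\right),$$ with $\alpha_{1D}(0)=r(r-1)$. (2) The corresponding eigenvalues of $L_{\mathrm{cl}}$ and $L_h$ are $$\lambda_{\mathrm{cl}}(k)=mr(r-1)-\alpha(k),\qquad \lambda_h(k)=mr-\frac{\alpha(k)}{r-1}.$$ (3) Each $k\in\mathbb{Z}_\ell^m$ corresponds to one eigenmode, so the multiplicity of $\lambda_{\mathrm{cl}}(k)$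 is the number of vectors $k'\in\mathbb{Z}_\ell^m$ with $\alpha(k')=\alpha(k)$. (4) The constant mode $k=0$ gives $\lambda_{\mathrm{cl}}(0)=\lambda_h(0)=0$, and this zero eigenvalue has multiplicity one; in particular $\mathcal{H}_r$ is connected.
   Context: Here $\mathbb{Z}_\ell=\{0,\dots,\ell-1\}$ with arithmetic modulo $\ell$, and $\mathbb{Z}_\ell^m$ is the discrete torus. Hyperlattice $\mathcal{H}_r$: for each direction $i\in\{1,\dots,m\}$, each $x_{\neq i}\in\mathbb{Z}_\ell^{m-1}$ (a choice of all coordinates other than the $i$-th) and each $a\in\mathbb{Z}_\ell$, there is a hyperedge $$H_i(a;x_{\neq i})=\{(x_1,\dots,x_m)\in V: x_j=(x_{\neq i})_j\ \text{for } j\ne i,\ x_i\in\{a,a+1,\dots,a+r-1\} \bmod \ell\}.$$ (The hyperedges with $a\equiv s \pmod r$, $a\in\{0,\dots,\ell-1\}$, form the offset class $\mathcal{C}_i^{(s)}$, $s\in\{0,\dots,r-1\}$, and $\mathcal{E}$ is the union of all offset classes over all $i$ and $s$.) Hyperedges are counted as a family indexed by $(i,a,x_{\neq i})$, with multiplicity, so every vertex lies in exactly $r$ hyperedges for each direction, hence in $mr$ hyperedges in total. Clique adjacency matrix: $A_{\mathrm{cl}}(u,u)=0$, and for $u\neq v$, $A_{\mathrm{cl}}(u,v)$ is the number of hyperedges (counted with multiplicity) containing both $u$ and $v$. Every vertex has clique degree $\sum_{v\ne u}A_{\mathrm{cl}}(u,v)=mr(r-1)$. "Block-circulant" means here that $A_{\mathrm{cl}}(x,y)$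 depends only on $x-y\in\mathbb{Z}_\ell^m$. A hypergraph is connected if any two vertices are joined by a chain of vertices in which consecutive ones lie in a common hyperedge. *)

theory Defs
  imports
    Complex_Main
    "HOL-Library.FuncSet"
    "Jordan_Normal_Form.Char_Poly"
    "Jordan_Normal_Form.Matrix_Kernel"
begin

section \<open>Hypergraphs as indexed families of hyperedges\<close>

text \<open>A hypergraph is given by a vertex set and a family of hyperedges \<open>H\<close> over an index
  set \<open>I\<close>; distinct indices count separately even if the hyperedges coincide as sets.\<close>

definition clique_adj :: "'e set \<Rightarrow> ('e \<Rightarrow> 'v set) \<Rightarrow> 'v \<Rightarrow> 'v \<Rightarrow> nat" where
  "clique_adj I H u v = (if u = v then 0 else card {e \<in> I. u \<in> H e \<and> v \<in> H e})"

definition hypergraph_connected :: "'v set \<Rightarrow> 'e set \<Rightarrow> ('e \<Rightarrow> 'v set) \<Rightarrow> bool" where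
  "hypergraph_connected V I H \<longleftrightarrow>
     (\<forall>u\<in>V. \<forall>v\<in>V. (u, v) \<in> {(x, y). \<exists>e\<in>I. x \<in> H e \<and> y \<in> H e}\<^sup>*)"


section \<open>The hyperlattice on the discrete torus\<close>

text \<open>Points of the torus are functions on the coordinate set \<open>{1..m}\<close> with values in
  \<open>{0..<l}\<close>, extended by \<^term>\<open>undefined\<close> elsewhere.\<close>

definition torus_on :: "nat \<Rightarrow> nat set \<Rightarrow> (nat \<Rightarrow> nat) set" where
  "torus_on l J = J \<rightarrow>\<^sub>E {0..<l}"

abbreviation torus :: "nat \<Rightarrow> nat \<Rightarrow> (nat \<Rightarrow> nat) set" where
  "torus l m \<equiv> torus_on l {1..m}"

text \<open>The natural-number subtraction below does not truncate on points of the torus, since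
  there \<open>y j < l\<close>.\<close>

definition torus_diff :: "nat \<Rightarrow> nat \<Rightarrow> (nat \<Rightarrow> nat) \<Rightarrow> (nat \<Rightarrow> nat) \<Rightarrow> nat \<Rightarrow> nat" where
  "torus_diff l m x y = (\<lambda>j\<in>{1..m}. (x j + (l - y j)) mod l)"

text \<open>A hyperedge index \<open>(i, a, z)\<close> consists of a direction \<open>i\<close>, a starting position \<open>a\<close> and
  the values \<open>z\<close> of all coordinates other than the \<open>i\<close>-th. As \<open>a\<close> ranges over all
  of \<open>{0..<l}\<close>, all offset classes modulo \<open>r\<close> are covered.\<close>

definition edge_index :: "nat \<Rightarrow> nat \<Rightarrow> (nat \<times> nat \<times> (nat \<Rightarrow> nat)) set" where
  "edge_index l m = (SIGMA i:{1..m}. {0..<l} \<times> torus_on l ({1..m} - {i}))"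

definition hyperedge ::
  "nat \<Rightarrow> nat \<Rightarrow> nat \<Rightarrow> nat \<times> nat \<times> (nat \<Rightarrow> nat) \<Rightarrow> (nat \<Rightarrow> nat) set" where
  "hyperedge l m r = (\<lambda>(i, a, z).
     {x \<in> torus l m. (\<forall>j\<in>{1..m} - {i}. x j = z j) \<and> x i \<in> {(a + d) mod l |d. d < r}})"

definition lattice_adj :: "nat \<Rightarrow> nat \<Rightarrow> nat \<Rightarrow> (nat \<Rightarrow> nat) \<Rightarrow> (nat \<Rightarrow> nat) \<Rightarrow> nat" where
  "lattice_adj l m r = clique_adj (edge_index l m) (hyperedge l m r)"


section \<open>Matrices\<close>

text \<open>Matrices and vectors indexed by the torus are turned into library matrices and vectors by
  means of a list \<open>vs\<close> enumerating its points without repetition.\<close>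

definition clique_adj_mat :: "nat \<Rightarrow> nat \<Rightarrow> nat \<Rightarrow> (nat \<Rightarrow> nat) list \<Rightarrow> complex mat" where
  "clique_adj_mat l m r vs =
     mat (length vs) (length vs) (\<lambda>(i, j). of_nat (lattice_adj l m r (vs ! i) (vs ! j)))"

definition clique_laplacian :: "nat \<Rightarrow> nat \<Rightarrow> nat \<Rightarrow> (nat \<Rightarrow> nat) list \<Rightarrow> complex mat" where
  "clique_laplacian l m r vs =
     (of_nat m * of_nat r * (of_nat r - 1)) \<cdot>\<^sub>m 1\<^sub>m (length vs) - clique_adj_mat l m r vs"

definition hyperedge_laplacian :: "nat \<Rightarrow> nat \<Rightarrow> nat \<Rightarrow> (nat \<Rightarrow> nat) list \<Rightarrow> complex mat" where
  "hyperedge_laplacian l m r vs =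
     (of_nat m * of_nat r) \<cdot>\<^sub>m 1\<^sub>m (length vs)
       - (1 / (of_nat r - 1)) \<cdot>\<^sub>m clique_adj_mat l m r vs"

text \<open>The algebraic and the geometric multiplicity of \<open>c\<close> are both \<open>n\<close>.\<close>

definition has_multiplicity :: "complex mat \<Rightarrow> complex \<Rightarrow> nat \<Rightarrow> bool" where
  "has_multiplicity M c n \<longleftrightarrow>
     Polynomial.order c (char_poly M) = n \<and> kernel_dim (char_matrix M c) = n"


section \<open>Fourier modes and eigenvalues\<close>

definition fourier :: "nat \<Rightarrow> nat \<Rightarrow> (nat \<Rightarrow> nat) \<Rightarrow> (nat \<Rightarrow> nat) \<Rightarrow> complex" where
  "fourier l m k x =
     exp (2 * of_real pi * \<i> / of_nat l * of_nat (\<Sum>j=1..m. k j * x j))"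

definition fourier_vec ::
  "nat \<Rightarrow> nat \<Rightarrow> (nat \<Rightarrow> nat) list \<Rightarrow> (nat \<Rightarrow> nat) \<Rightarrow> complex vec" where
  "fourier_vec l m vs k = vec (length vs) (\<lambda>i. fourier l m k (vs ! i))"

definition alpha1D :: "nat \<Rightarrow> nat \<Rightarrow> nat \<Rightarrow> real" where
  "alpha1D l r q =
     2 * (\<Sum>d=1..r-1. (real r - real d) * cos (2 * pi * real q * real d / real l))"

definition alpha :: "nat \<Rightarrow> nat \<Rightarrow> nat \<Rightarrow> (nat \<Rightarrow> nat) \<Rightarrow> real" where
  "alpha l m r k = (\<Sum>j=1..m. alpha1D l r (k j))"

definition lambda_cl :: "nat \<Rightarrow> nat \<Rightarrow> nat \<Rightarrow> (nat \<Rightarrow> nat) \<Rightarrow> real" where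
  "lambda_cl l m r k = real m * real r * (real r - 1) - alpha l m r k"

definition lambda_h :: "nat \<Rightarrow> nat \<Rightarrow> nat \<Rightarrow> (nat \<Rightarrow> nat) \<Rightarrow> real" where
  "lambda_h l m r k = real m * real r - alpha l m r k / (real r - 1)"

end

theory Submission
  imports Defs "Jordan_Normal_Form.Jordan_Normal_Form_Uniqueness"
begin

text \<open>Let \<open>B u v\<close> count the hyperedges containing \<open>u\<close> and \<open>v\<close>, without exception for
  \<open>u = v\<close>; it is the clique adjacency plus \<open>m r I\<close>. A hyperedge through \<open>u\<close> is given by a
  direction \<open>i\<close> and the offset \<open>s < r\<close> of \<open>u\<close> in its window, and its points are \<open>u\<close> shifted
  by \<open>t - s\<close> in direction \<open>i\<close> for \<open>t < r\<close>. Hence \<open>B\<close> multiplies the mode \<open>k\<close> by the sum over \<open>i\<close>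
  of the double sums of \<open>\<omega> ^ (k i * (t - s))\<close> over \<open>s, t < r\<close>, where \<open>\<omega>\<close> is the primitive
  \<open>l\<close>-th root of unity; each equals \<open>r\<close> plus the one-dimensional eigenvalue. Orthogonality
  of the modes makes them a basis, so the multiplicities can be read off the resulting
  diagonalization. As \<open>r \<ge> 2\<close>, the term \<open>d = 1\<close> of the cosine sum shows that \<open>\<alpha>\<close> attains its
  maximum only at \<open>k = 0\<close>.\<close>

section \<open>Roots of unity\<close>

text \<open>The exponent is an integer so that differences of coordinates can be used without
  truncation.\<close>

definition unity_root :: "nat \<Rightarrow> int \<Rightarrow> complex" where
  "unity_root l t = cis (2 * pi * of_int t / of_nat l)"

lemma unity_root_0 [simp]: "unity_root l 0 = 1"
  by (simp add: unity_root_def)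

lemma unity_root_add: "unity_root l (s + t) = unity_root l s * unity_root l t"
  by (simp add: unity_root_def cis_mult add_divide_distrib ring_distribs)

lemma unity_root_sum: "unity_root l (\<Sum>x\<in>X. f x) = (\<Prod>x\<in>X. unity_root l (f x))"
  by (induction X rule: infinite_finite_induct) (auto simp: unity_root_add)

lemma cnj_unity_root: "cnj (unity_root l t) = unity_root l (- t)"
  by (simp add: unity_root_def cis_cnj)

lemma unity_root_power: "unity_root l t ^ n = unity_root l (int n * t)"
  by (simp add: unity_root_def DeMoivre mult_ac)

lemma cos_eq_1_iff_dvd:
  assumes "l > 0"
  shows "cos (2 * pi * of_int t / real l) = 1 \<longleftrightarrow> int l dvd t"
proof -
  have "2 * pi * of_int t / real l = real_of_int n * 2 * pi \<longleftrightarrow> t = int l * n" for n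
  proof -
    have "2 * pi * of_int t / real l = real_of_int n * 2 * pi
        \<longleftrightarrow> real_of_int t = real_of_int (int l * n)"
      using assms by (simp add: field_simps)
    then show ?thesis by (simp only: of_int_eq_iff)
  qed
  then show ?thesis by (simp add: cos_one_2pi_int dvd_def)
qed

lemma unity_root_eq_1_iff:
  assumes "l > 0"
  shows "unity_root l t = 1 \<longleftrightarrow> int l dvd t"
proof -
  \<comment> \<open>The real part alone decides: where the cosine is 1, the sine vanishes.\<close>
  have "sin a = 0" if "cos a = 1" for a :: real
    using that sin_squared_eq[of a] by simp
  then show ?thesis
    using cos_eq_1_iff_dvd[OF assms, of t] by (auto simp: unity_root_def complex_eq_iff)
qed

text \<open>This is the tool for discarding every \<open>mod l\<close> inside an exponent.\<close>

lemma unity_root_cong: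
  assumes "l > 0" and "int l dvd s - t"
  shows "unity_root l s = unity_root l t"
  using assms unity_root_add[of l "s - t" t] by (simp add: unity_root_eq_1_iff)

lemma int_dvd_mod_diff: "int l dvd int (n mod l) - int n"
  by (simp add: of_nat_mod flip: mod_eq_dvd_iff)

text \<open>A geometric series whose ratio \<open>z\<close> satisfies \<open>z ^ l = 1\<close>. The
  bounds give |x - y| < l, so \<open>z = 1\<close> only for \<open>x = y\<close>.\<close>

lemma sum_unity_root:
  assumes "x < l" and "y < l"
  shows "(\<Sum>q<l. unity_root l (int q * (int x - int y))) = (if x = y then of_nat l else 0)"
proof (cases "x = y")
  case False
  define z where "z = unity_root l (int x - int y)"
  have "\<not> int l dvd int x - int y"
    using assms False zdvd_not_zless[of "\<bar>int x - int y\<bar>" "int l"] by auto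
  then have "z \<noteq> 1"
    using assms by (simp add: z_def unity_root_eq_1_iff)
  moreover have "z ^ l = 1"
    using assms by (simp add: z_def unity_root_power unity_root_eq_1_iff)
  ultimately have "(\<Sum>q<l. z ^ q) = 0"
    by (simp add: geometric_sum)
  then show ?thesis
    using False by (simp add: z_def unity_root_power)
qed simp

section \<open>The one-dimensional eigenvalue and its maximum\<close>

lemma alpha1D_Suc: "alpha1D l (Suc r) q =
    alpha1D l r q + 2 * (\<Sum>d=1..r. cos (2 * pi * real q * real d / real l))"
proof -
  \<comment> \<open>The appended term \<open>d = r\<close> has weight 0. With equal ranges, each
    weight grows by exactly 1 when \<open>r\<close> does.\<close>
  have "(\<Sum>d=1..r-1. (real r - real d) * cos (2 * pi * real q * real d / real l))
      = (\<Sum>d=1..r. (real r - real d) * cos (2 * pi * real q * real d / real l))"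
    by (cases r) auto
  then show ?thesis
    unfolding alpha1D_def by (simp add: sum.distrib[symmetric] algebra_simps flip: sum_distrib_left distrib_left)
qed

text \<open>Passing from \<open>r\<close> to \<open>r + 1\<close> adds a row, a column and a
  diagonal entry 1. The row and column together give the cosine sum of
  \<open>alpha1D_Suc\<close>.\<close>

lemma window_sum:
  "(\<Sum>s<r. \<Sum>t<r. unity_root l (int q * (int t - int s))) = of_real (real r + alpha1D l r q)"
proof (induction r)
  case 0
  then show ?case by (simp add: alpha1D_def)
next
  case (Suc r)
  let ?w = "\<lambda>t. unity_root l (int q * t)"
  \<comment> \<open>With \<open>d = r - s\<close>, mirror entries of the new row and column are
    conjugate and add up to twice a cosine.\<close>
  have "(\<Sum>s<r. ?w (int r - int s) + ?w (int s - int r)) = (\<Sum>d=1..r. ?w (int d) + ?w (- int d))"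
    by (rule sum.reindex_bij_witness[of _ "\<lambda>d. r - d" "\<lambda>s. r - s"]) (auto simp: of_nat_diff)
  also have "\<dots> = (\<Sum>d=1..r. of_real (2 * cos (2 * pi * real q * real d / real l)))"
    by (rule sum.cong) (simp_all add: unity_root_def complex_eq_iff mult_ac)
  finally have "(\<Sum>s<r. ?w (int r - int s)) + (\<Sum>t<r. ?w (int t - int r))
      = of_real (2 * (\<Sum>d=1..r. cos (2 * pi * real q * real d / real l)))"
    by (simp add: sum.distrib sum_distrib_left)
  with Suc show ?case
    by (simp add: sum.distrib alpha1D_Suc algebra_simps)
qed

text \<open>At \<open>q = 0\<close> all \<open>r * r\<close> terms of \<open>window_sum\<close> are
  1.\<close>

lemma alpha1D_0: "alpha1D l r 0 = real r * (real r - 1)"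
proof -
  have "complex_of_real (real r + alpha1D l r 0) = of_real (real r * real r)"
    unfolding window_sum[of _ _ r, symmetric] by simp
  then show ?thesis
    unfolding of_real_eq_iff by (simp add: algebra_simps)
qed

lemma alpha1D_le: "alpha1D l r q \<le> real r * (real r - 1)"
proof -
  have "alpha1D l r q \<le> alpha1D l r 0"
    unfolding alpha1D_def by (intro mult_left_mono sum_mono) auto
  then show ?thesis by (simp add: alpha1D_0)
qed

lemma alpha1D_eq_max_iff:
  assumes "2 \<le> r" and "q < l"
  shows "alpha1D l r q = real r * (real r - 1) \<longleftrightarrow> q = 0"
proof
  assume *: "alpha1D l r q = real r * (real r - 1)"
  show "q = 0"
  proof (rule ccontr)
    assume "q \<noteq> 0"
    then have "\<not> int l dvd int q"
      using assms by (auto dest: zdvd_imp_le)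
    then have "cos (2 * pi * real q / real l) \<noteq> 1"
      using cos_eq_1_iff_dvd[of l "int q"] assms by auto
    then have "cos (2 * pi * real q / real l) < 1"
      by (simp add: order_less_le)
    \<comment> \<open>Strictness comes from \<open>d = 1\<close>, which is in range with positive
      weight \<open>r - 1\<close> because \<open>r\<close> \<ge> 2.\<close>
    then have "(\<Sum>d=1..r-1. (real r - real d) * cos (2 * pi * real q * real d / real l))
        < (\<Sum>d=1..r-1. (real r - real d) * cos (2 * pi * real 0 * real d / real l))"
      using assms by (intro sum_strict_mono_ex1 ballI bexI[of _ 1]) (auto simp: mult_left_le)
    then have "alpha1D l r q < alpha1D l r 0"
      unfolding alpha1D_def by simp
    with * show False by (simp add: alpha1D_0)
  qed
qed (simp add: alpha1D_0)

section \<open>Fourier modes\<close>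

text \<open>Otherwise the simplifier turns \<^term>\<open>{1..m}\<close> inside \<^term>\<open>torus l m\<close> into
  \<open>{Suc 0..m}\<close>, and facts about the torus no longer match.\<close>

declare One_nat_def [simp del]

lemma finite_torus [simp]: "finite (torus l m)"
  by (simp add: torus_on_def finite_PiE)

lemma torus_lt: "x \<in> torus l m \<Longrightarrow> j \<in> {1..m} \<Longrightarrow> x j < l"
  by (auto simp: torus_on_def)

lemma torus_eqI:
  "x \<in> torus l m \<Longrightarrow> y \<in> torus l m \<Longrightarrow> (\<And>j. j \<in> {1..m} \<Longrightarrow> x j = y j) \<Longrightarrow> x = y"
  unfolding torus_on_def by (rule PiE_ext)

lemma torus_upd: "x \<in> torus l m \<Longrightarrow> i \<in> {1..m} \<Longrightarrow> c < l \<Longrightarrow> x(i := c) \<in> torus l m"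
  by (auto simp: torus_on_def PiE_iff extensional_def)

lemma zero_in_torus: "0 < l \<Longrightarrow> (\<lambda>j\<in>{1..m}. 0) \<in> torus l m"
  by (auto simp: torus_on_def)

text \<open>In this separated form a change of one coordinate affects one factor, and sums over all
  modes factorize.\<close>

lemma fourier_eq_prod: "fourier l m k x = (\<Prod>j=1..m. unity_root l (int (k j) * int (x j)))"
proof -
  have "fourier l m k x = unity_root l (\<Sum>j=1..m. int (k j) * int (x j))"
    by (simp add: fourier_def unity_root_def cis_conv_exp mult_ac)
  then show ?thesis by (simp add: unity_root_sum)
qed

lemma fourier_commute: "fourier l m k x = fourier l m x k"
  by (simp add: fourier_def mult.commute)

lemma fourier_neq_0: "fourier l m k x \<noteq> 0"
  by (simp add: fourier_def)

lemma fourier_upd: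
  assumes "i \<in> {1..m}"
  shows "fourier l m k (x(i := c)) = fourier l m k x * unity_root l (int (k i) * (int c - int (x i)))"
proof -
  have "unity_root l (int (k i) * int c)
      = unity_root l (int (k i) * int (x i)) * unity_root l (int (k i) * (int c - int (x i)))"
    by (simp add: algebra_simps flip: unity_root_add)
  moreover have "(\<Prod>j\<in>{1..m}-{i}. unity_root l (int (k j) * int ((x(i := c)) j)))
      = (\<Prod>j\<in>{1..m}-{i}. unity_root l (int (k j) * int (x j)))"
    by (rule prod.cong) auto
  ultimately show ?thesis
    using assms by (simp add: fourier_eq_prod prod.remove[of _ i])
qed

lemma fourier_mult_cnj:
  "fourier l m k x * cnj (fourier l m k y) =
    (\<Prod>j=1..m. unity_root l (int (k j) * (int (x j) - int (y j))))"
  by (simp add: fourier_eq_prod cnj_unity_root flip: prod.distrib unity_root_add)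
    (simp add: algebra_simps)

text \<open>Modes are characters of the torus group with values on the unit circle, so conjugation
  inverts them. The summand \<open>l\<close> and the reduction in \<open>torus_diff\<close> only
  change exponents by multiples of \<open>l\<close>.\<close>

lemma fourier_torus_diff:
  assumes "0 < l" and "y \<in> torus l m"
  shows "fourier l m k (torus_diff l m x y) = fourier l m k x * cnj (fourier l m k y)"
proof -
  have "unity_root l (int (k j) * int ((x j + (l - y j)) mod l))
      = unity_root l (int (k j) * (int (x j) - int (y j)))" if "j \<in> {1..m}" for j
  proof (rule unity_root_cong[OF assms(1)])
    have "int (x j + (l - y j)) = int (x j) - int (y j) + int l"
      using torus_lt[OF assms(2) that] by simp
    with int_dvd_mod_diff[of l "x j + (l - y j)"]
    have "int l dvd (int ((x j + (l - y j)) mod l) - (int (x j) - int (y j))) - int l"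
      by (simp add: algebra_simps)
    then have "int l dvd int ((x j + (l - y j)) mod l) - (int (x j) - int (y j))"
      by (metis diff_add_cancel dvd_add dvd_refl)
    then show "int l dvd int (k j) * int ((x j + (l - y j)) mod l) - int (k j) * (int (x j) - int (y j))"
      by (simp flip: right_diff_distrib)
  qed
  then show ?thesis
    by (simp add: fourier_mult_cnj) (simp add: fourier_eq_prod torus_diff_def)
qed

text \<open>The sum runs over modes with the points fixed. It splits into one geometric sum per
  coordinate, and one differing coordinate makes the product vanish.\<close>

lemma fourier_orthogonal:
  assumes "x \<in> torus l m" and "y \<in> torus l m"
  shows "(\<Sum>k\<in>torus l m. fourier l m k x * cnj (fourier l m k y)) = (if x = y then of_nat (l ^ m) else 0)"
proof -
  have "(\<Sum>k\<in>torus l m. fourier l m k x * cnj (fourier l m k y))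
      = (\<Prod>j=1..m. \<Sum>q\<in>{0..<l}. unity_root l (int q * (int (x j) - int (y j))))"
    unfolding fourier_mult_cnj torus_on_def by (rule prod_sum_PiE[symmetric]) auto
  also have "\<dots> = (\<Prod>j=1..m. if x j = y j then of_nat l else 0)"
    using assms by (intro prod.cong refl) (simp add: atLeast0LessThan sum_unity_root torus_lt)
  also have "\<dots> = (if x = y then of_nat (l ^ m) else 0)"
    using torus_eqI[OF assms] by auto
  finally show ?thesis .
qed

section \<open>Hyperedges through a point\<close>

text \<open>Converts between a point \<open>u\<close> of a cyclic window and the start
  \<open>a\<close> lying \<open>s\<close> places before it.\<close>

lemma add_diff_mod_eq_iff:
  fixes u s a l :: nat
  assumes "u < l" and "s < l" and "a < l"
  shows "(u + (l - s)) mod l = a \<longleftrightarrow> (a + s) mod l = u"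
proof -
  have "(u + (l - s)) mod l = (if s \<le> u then u - s else u + (l - s))"
    using assms by (auto simp: mod_if)
  moreover have "(a + s) mod l = (if a + s < l then a + s else a + s - l)"
    using assms by (auto simp: mod_if)
  ultimately show ?thesis using assms by auto
qed

text \<open>Distinct offsets below \<open>l\<close> differ by less than \<open>l\<close>. With
  \<open>r\<close> \<le> \<open>l\<close> this keeps windows free of repetitions.\<close>

lemma inj_on_add_mod: "inj_on (\<lambda>t. (a + t) mod l) {..<(l::nat)}"
proof (rule inj_onI)
  fix s t assume *: "s \<in> {..<l}" "t \<in> {..<l}" "(a + s) mod l = (a + t) mod l"
  then have "int l dvd (int a + int s) - (int a + int t)"
    by (metis mod_eq_dvd_iff of_nat_add of_nat_mod)
  then have dvd: "int l dvd \<bar>int s - int t\<bar>" by simp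
  have "\<bar>int s - int t\<bar> < int l" using * by auto
  with dvd zdvd_not_zless[of "\<bar>int s - int t\<bar>" "int l"] show "s = t" by fastforce
qed

text \<open>Here \<open>s\<close> is the offset of \<open>u\<close> in the window. Indices rather
  than sets are produced, so for \<open>r = l\<close> the coinciding windows of one direction still
  count \<open>r\<close> times.\<close>

definition edge_through :: "nat \<Rightarrow> nat \<Rightarrow> (nat \<Rightarrow> nat) \<Rightarrow> nat \<times> nat \<Rightarrow> nat \<times> nat \<times> (nat \<Rightarrow> nat)" where
  "edge_through l m u = (\<lambda>(i, s). (i, (u i + (l - s)) mod l, restrict u ({1..m} - {i})))"

lemma hyperedge_subset_torus: "hyperedge l m r e \<subseteq> torus l m"
  by (auto simp: hyperedge_def split: prod.splits)

lemma finite_edge_index [simp]: "finite (edge_index l m)"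
  by (auto simp: edge_index_def torus_on_def intro!: finite_SigmaI finite_PiE)

lemma bij_betw_edge_through:
  assumes u: "u \<in> torus l m" and "r \<le> l"
  shows "bij_betw (edge_through l m u) ({1..m} \<times> {..<r}) {e \<in> edge_index l m. u \<in> hyperedge l m r e}"
proof (rule bij_betw_imageI)
  have start: "((u i + (l - s)) mod l + s) mod l = u i" if "i \<in> {1..m}" "s < r" for i s
    using add_diff_mod_eq_iff[of "u i" l s "(u i + (l - s)) mod l"] torus_lt[OF u that(1)] that assms
    by simp
  show "inj_on (edge_through l m u) ({1..m} \<times> {..<r})"
  proof (rule inj_onI)
    fix p q assume "p \<in> {1..m} \<times> {..<r}" "q \<in> {1..m} \<times> {..<r}" "edge_through l m u p = edge_through l m u q"
    then obtain i s t where *: "p = (i, s)" "q = (i, t)" "i \<in> {1..m}" "s < r" "t < r"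
      "(u i + (l - s)) mod l = (u i + (l - t)) mod l"
      by (auto simp: edge_through_def)
    \<comment> \<open>From the common start, both offsets lead to \<open>u i\<close>, hence they
      agree.\<close>
    then have "((u i + (l - s)) mod l + s) mod l = ((u i + (l - s)) mod l + t) mod l"
      using start[of i s] start[of i t] by metis
    from inj_onD[OF inj_on_add_mod this] show "p = q"
      using * assms by simp
  qed
  show "edge_through l m u ` ({1..m} \<times> {..<r}) = {e \<in> edge_index l m. u \<in> hyperedge l m r e}"
  proof (intro equalityI subsetI)
    fix e assume "e \<in> edge_through l m u ` ({1..m} \<times> {..<r})"
    then obtain i s where *: "i \<in> {1..m}" "s < r" "e = edge_through l m u (i, s)" by auto
    have "restrict u ({1..m} - {i}) \<in> torus_on l ({1..m} - {i})"
      using u by (auto simp: torus_on_def)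
    moreover have "0 < l" using torus_lt[OF u *(1)] by simp
    ultimately show "e \<in> {e \<in> edge_index l m. u \<in> hyperedge l m r e}"
      using * u start[OF *(1,2)]
      by (auto simp: edge_through_def edge_index_def hyperedge_def intro!: exI[of _ s])
  next
    fix e assume "e \<in> {e \<in> edge_index l m. u \<in> hyperedge l m r e}"
    then obtain i a z d where *: "e = (i, a, z)" "i \<in> {1..m}" "a < l" "z \<in> torus_on l ({1..m} - {i})"
      "\<And>j. j \<in> {1..m} - {i} \<Longrightarrow> u j = z j" "u i = (a + d) mod l" "d < r"
      by (auto simp: edge_index_def hyperedge_def)
    \<comment> \<open>Both sides are extensional, so agreement off \<open>i\<close> is full
      equality.\<close>
    have "z = restrict u ({1..m} - {i})"
      using *(4,5) by (auto simp: torus_on_def PiE_iff fun_eq_iff extensional_def restrict_def)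
    moreover have "(u i + (l - d)) mod l = a"
      using add_diff_mod_eq_iff[of "u i" l d a] * assms torus_lt[OF u *(2)] by auto
    ultimately have "e = edge_through l m u (i, d)"
      using * by (simp add: edge_through_def)
    then show "e \<in> edge_through l m u ` ({1..m} \<times> {..<r})"
      using * by blast
  qed
qed

text \<open>The points of the window are parametrized by their offset \<open>t\<close>, injectively
  since \<open>r\<close> \<le> \<open>l\<close>.\<close>

lemma sum_hyperedge_through:
  assumes u: "u \<in> torus l m" and "r \<le> l" and i: "i \<in> {1..m}"
  shows "(\<Sum>v\<in>hyperedge l m r (edge_through l m u (i, s)). f v)
    = (\<Sum>t<r. f (u(i := ((u i + (l - s)) mod l + t) mod l)))"
proof -
  define a where "a = (u i + (l - s)) mod l"
  have "0 < l" using torus_lt[OF u i] by simp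
  have "bij_betw (\<lambda>t. u(i := (a + t) mod l)) {..<r} (hyperedge l m r (edge_through l m u (i, s)))"
  proof (rule bij_betw_imageI)
    show "inj_on (\<lambda>t. u(i := (a + t) mod l)) {..<r}"
    proof (rule inj_onI)
      fix t t' assume *: "t \<in> {..<r}" "t' \<in> {..<r}" "u(i := (a + t) mod l) = u(i := (a + t') mod l)"
      then have "(a + t) mod l = (a + t') mod l" by (metis fun_upd_same)
      with * show "t = t'" using inj_onD[OF inj_on_add_mod, of a t l t'] assms(2) by auto
    qed
    show "(\<lambda>t. u(i := (a + t) mod l)) ` {..<r} = hyperedge l m r (edge_through l m u (i, s))"
    proof (intro equalityI subsetI)
      fix x assume "x \<in> (\<lambda>t. u(i := (a + t) mod l)) ` {..<r}"
      then show "x \<in> hyperedge l m r (edge_through l m u (i, s))"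
        using torus_upd[OF u i] \<open>0 < l\<close> by (auto simp: hyperedge_def edge_through_def a_def split: if_splits)
    next
      fix x assume "x \<in> hyperedge l m r (edge_through l m u (i, s))"
      then obtain t where x: "x \<in> torus l m" "\<And>j. j \<in> {1..m} - {i} \<Longrightarrow> x j = u j"
        "x i = (a + t) mod l" "t < r"
        by (auto simp: hyperedge_def edge_through_def a_def)
      have "x = u(i := (a + t) mod l)"
        using x \<open>0 < l\<close> by (intro torus_eqI[OF x(1) torus_upd[OF u i]]) auto
      with x(4) show "x \<in> (\<lambda>t. u(i := (a + t) mod l)) ` {..<r}" by blast
    qed
  qed
  then show ?thesis
    by (simp add: sum.reindex_bij_betw[symmetric] a_def)
qed

text \<open>Double counting: each count becomes a sum of indicators over the hyperedges through
  \<open>u\<close>, and the two summations are exchanged.\<close>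

lemma sum_common_edges:
  fixes f :: "(nat \<Rightarrow> nat) \<Rightarrow> complex"
  assumes u: "u \<in> torus l m" and "r \<le> l"
  shows "(\<Sum>v\<in>torus l m. of_nat (card {e \<in> edge_index l m. u \<in> hyperedge l m r e \<and> v \<in> hyperedge l m r e}) * f v)
    = (\<Sum>i=1..m. \<Sum>s<r. \<Sum>t<r. f (u(i := ((u i + (l - s)) mod l + t) mod l)))"
proof -
  let ?H = "hyperedge l m r" and ?E = "{e \<in> edge_index l m. u \<in> hyperedge l m r e}"
  have "of_nat (card {e \<in> edge_index l m. u \<in> ?H e \<and> v \<in> ?H e}) * f v
      = (\<Sum>e\<in>?E. if v \<in> ?H e then f v else 0)" for v
  proof -
    have "{e \<in> edge_index l m. u \<in> ?H e \<and> v \<in> ?H e} = ?E \<inter> {e. v \<in> ?H e}" by auto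
    then show ?thesis by (simp add: sum.If_cases)
  qed
  then have "(\<Sum>v\<in>torus l m. of_nat (card {e \<in> edge_index l m. u \<in> ?H e \<and> v \<in> ?H e}) * f v)
      = (\<Sum>v\<in>torus l m. \<Sum>e\<in>?E. if v \<in> ?H e then f v else 0)"
    by simp
  also have "\<dots> = (\<Sum>e\<in>?E. \<Sum>v\<in>torus l m. if v \<in> ?H e then f v else 0)"
    by (rule sum.swap)
  also have "\<dots> = (\<Sum>e\<in>?E. \<Sum>v\<in>?H e. f v)"
    using hyperedge_subset_torus[of l m r] by (intro sum.cong sum.mono_neutral_cong_right refl) auto
  also have "\<dots> = (\<Sum>p\<in>{1..m} \<times> {..<r}. \<Sum>v\<in>?H (edge_through l m u p). f v)"
    by (rule sum.reindex_bij_betw[OF bij_betw_edge_through[OF assms], symmetric])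
  also have "\<dots> = (\<Sum>i=1..m. \<Sum>s<r. \<Sum>v\<in>?H (edge_through l m u (i, s)). f v)"
    by (simp add: sum.cartesian_product)
  also have "\<dots> = (\<Sum>i=1..m. \<Sum>s<r. \<Sum>t<r. f (u(i := ((u i + (l - s)) mod l + t) mod l)))"
    using sum_hyperedge_through[OF assms] by (intro sum.cong refl) simp
  finally show ?thesis .
qed

section \<open>Action of the adjacency on Fourier modes\<close>

lemma card_edges_through:
  assumes "u \<in> torus l m" and "r \<le> l"
  shows "card {e \<in> edge_index l m. u \<in> hyperedge l m r e} = m * r"
  using bij_betw_same_card[OF bij_betw_edge_through[OF assms]] by simp

lemma sum_lattice_adj_fourier:
  assumes u: "u \<in> torus l m" and rl: "r \<le> l" and "0 < l"
  shows "(\<Sum>v\<in>torus l m. of_nat (lattice_adj l m r u v) * fourier l m k v)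
    = of_real (alpha l m r k) * fourier l m k u"
proof -
  let ?c = "\<lambda>v. card {e \<in> edge_index l m. u \<in> hyperedge l m r e \<and> v \<in> hyperedge l m r e}"
  have "fourier l m k (u(i := ((u i + (l - s)) mod l + t) mod l))
      = fourier l m k u * unity_root l (int (k i) * (int t - int s))"
    if i: "i \<in> {1..m}" and s: "s < r" for i s t
  proof -
    let ?a = "(u i + (l - s)) mod l"
    have "(?a + s) mod l = u i"
      using add_diff_mod_eq_iff[of "u i" l s ?a] torus_lt[OF u i] s assms by simp
    then have *: "int l dvd int (u i) - int (?a + s)"
      using int_dvd_mod_diff[of l "?a + s"] by simp
    \<comment> \<open>Modulo \<open>l\<close> the new coordinate is \<open>?a + t\<close> and the
      old one is \<open>?a + s\<close>, so the shift is \<open>t - s\<close>.\<close>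
    have "int l dvd (int ((?a + t) mod l) - int (?a + t)) - (int (u i) - int (?a + s))"
      by (rule dvd_diff[OF int_dvd_mod_diff *])
    then have "int l dvd int (k i) * (int ((?a + t) mod l) - int (u i) - (int t - int s))"
      by (intro dvd_mult) (simp add: algebra_simps)
    then show ?thesis
      unfolding fourier_upd[OF i]
      by (intro arg_cong[of _ _ "(*) _"] unity_root_cong[OF \<open>0 < l\<close>]) (simp add: right_diff_distrib)
  qed
  then have "(\<Sum>v\<in>torus l m. of_nat (?c v) * fourier l m k v)
      = (\<Sum>i=1..m. \<Sum>s<r. \<Sum>t<r. fourier l m k u * unity_root l (int (k i) * (int t - int s)))"
    unfolding sum_common_edges[OF u rl] by simp
  also have "\<dots> = fourier l m k u * (\<Sum>i=1..m. of_real (real r + alpha1D l r (k i)))"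
    by (simp only: window_sum flip: sum_distrib_left)
  also have "\<dots> = of_nat (m * r) * fourier l m k u + of_real (alpha l m r k) * fourier l m k u"
    by (simp add: alpha_def sum.distrib algebra_simps)
  finally have *: "(\<Sum>v\<in>torus l m. of_nat (?c v) * fourier l m k v)
      = of_nat (m * r) * fourier l m k u + of_real (alpha l m r k) * fourier l m k u" .
  \<comment> \<open>The count \<open>?c\<close> includes the diagonal, where it equals the degree
    \<open>m * r\<close>; the clique adjacency is 0 there.\<close>
  have "of_nat (lattice_adj l m r u v) * fourier l m k v
      = of_nat (?c v) * fourier l m k v - (if v = u then of_nat (m * r) * fourier l m k u else 0)" for v
    using card_edges_through[OF u rl] by (auto simp: lattice_adj_def clique_adj_def)
  then show ?thesis
    using u by (simp add: sum_subtractf *)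
qed

text \<open>Fourier inversion expresses the adjacency through products
  \<^term>\<open>fourier l m k x * cnj (fourier l m k y)\<close>, which depend on the difference only.\<close>

lemma lattice_adj_spectral:
  assumes "x \<in> torus l m" and "y \<in> torus l m" and "r \<le> l" and "0 < l"
  shows "of_nat (l ^ m) * of_nat (lattice_adj l m r x y)
    = (\<Sum>k\<in>torus l m. of_real (alpha l m r k) * fourier l m k (torus_diff l m x y))"
proof -
  let ?T = "torus l m" and ?f = "fourier l m" and ?A = "\<lambda>v. of_nat (lattice_adj l m r x v) :: complex"
  have "(\<Sum>k\<in>?T. of_real (alpha l m r k) * ?f k (torus_diff l m x y))
      = (\<Sum>k\<in>?T. (\<Sum>v\<in>?T. ?A v * ?f k v) * cnj (?f k y))"
    using assms by (intro sum.cong refl) (simp only: sum_lattice_adj_fourier fourier_torus_diff mult.assoc)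
  also have "\<dots> = (\<Sum>k\<in>?T. \<Sum>v\<in>?T. ?A v * (?f k v * cnj (?f k y)))"
    by (simp add: sum_distrib_right mult.assoc)
  also have "\<dots> = (\<Sum>v\<in>?T. \<Sum>k\<in>?T. ?A v * (?f k v * cnj (?f k y)))"
    by (rule sum.swap)
  also have "\<dots> = (\<Sum>v\<in>?T. if v = y then of_nat (l ^ m) * ?A y else 0)"
    using assms by (intro sum.cong refl) (simp add: fourier_orthogonal flip: sum_distrib_left)
  also have "\<dots> = of_nat (l ^ m) * ?A y"
    using assms by simp
  finally show ?thesis by simp
qed

lemma lattice_adj_circulant:
  assumes "r \<le> l" and "0 < l"
  shows "\<exists>g. \<forall>x\<in>torus l m. \<forall>y\<in>torus l m. lattice_adj l m r x y = g (torus_diff l m x y)"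
proof -
  define F where "F w = (\<Sum>k\<in>torus l m. of_real (alpha l m r k) * fourier l m k w)" for w
  \<comment> \<open>At such differences \<open>F\<close> is a natural number times
    \<open>l ^ m\<close>, so real part, floor and division decode it exactly.\<close>
  have "lattice_adj l m r x y = nat \<lfloor>Re (F (torus_diff l m x y))\<rfloor> div l ^ m"
    if "x \<in> torus l m" "y \<in> torus l m" for x y
  proof -
    have "F (torus_diff l m x y) = of_nat (l ^ m * lattice_adj l m r x y)"
      using lattice_adj_spectral[OF that assms] by (simp add: F_def)
    then have "Re (F (torus_diff l m x y)) = real (l ^ m * lattice_adj l m r x y)"
      by (simp only: complex_Re_of_nat)
    then show ?thesis
      using assms by (simp only: floor_of_nat nat_int) simp
  qed
  then show ?thesis by (intro exI[of _ "\<lambda>w. nat \<lfloor>Re (F w)\<rfloor> div l ^ m"]) blast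
qed

section \<open>Uniqueness of the zero mode, and connectedness\<close>

lemma alpha_eq_max_iff:
  assumes "2 \<le> r" and "k \<in> torus l m"
  shows "alpha l m r k = real m * real r * (real r - 1) \<longleftrightarrow> k = (\<lambda>j\<in>{1..m}. 0)"
proof
  assume "alpha l m r k = real m * real r * (real r - 1)"
  \<comment> \<open>A sum of nonnegative gaps vanishes only if every gap does.\<close>
  then have "(\<Sum>j=1..m. real r * (real r - 1) - alpha1D l r (k j)) = 0"
    by (simp add: alpha_def sum_subtractf)
  then have "\<forall>j\<in>{1..m}. alpha1D l r (k j) = real r * (real r - 1)"
    using alpha1D_le by (subst (asm) sum_nonneg_eq_0_iff) auto
  then have *: "\<forall>j\<in>{1..m}. k j = 0"
    using alpha1D_eq_max_iff[OF assms(1)] torus_lt[OF assms(2)] by blast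
  with assms(2) show "k = (\<lambda>j\<in>{1..m}. 0)"
    by (auto simp: torus_on_def PiE_iff extensional_def fun_eq_iff)
qed (simp add: alpha_def alpha1D_0)

text \<open>A direct walk: since \<open>r\<close> \<ge> 2, cyclic neighbours share a window, so each
  coordinate in turn can be moved to its target.\<close>

lemma hyperlattice_connected:
  assumes "2 \<le> r" and "r \<le> l"
  shows "hypergraph_connected (torus l m) (edge_index l m) (hyperedge l m r)"
  unfolding hypergraph_connected_def
proof (intro ballI)
  fix u v assume u: "u \<in> torus l m" and v: "v \<in> torus l m"
  let ?R = "{(x, y). \<exists>e\<in>edge_index l m. x \<in> hyperedge l m r e \<and> y \<in> hyperedge l m r e}"
  have "0 < l" using assms by simp
  have shift: "(x, x(i := (x i + n) mod l)) \<in> ?R\<^sup>*" if x: "x \<in> torus l m" and i: "i \<in> {1..m}" for x i n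
  proof (induction n)
    case 0
    then show ?case using torus_lt[OF x i] by simp
  next
    case (Suc n)
    let ?y = "\<lambda>n. x(i := (x i + n) mod l)" and ?a = "(x i + n) mod l"
    \<comment> \<open>The window starting at the current point contains it at offset 0 and its
      successor at offset 1.\<close>
    let ?e = "(i, ?a, restrict x ({1..m} - {i}))"
    have "?e \<in> edge_index l m"
      using x i \<open>0 < l\<close> by (auto simp: edge_index_def torus_on_def)
    moreover have "x(i := c mod l) \<in> torus l m" for c
      using torus_upd[OF x i] \<open>0 < l\<close> by simp
    moreover have "\<exists>d. (x i + n) mod l = (?a + d) mod l \<and> d < r"
      using assms by (intro exI[of _ 0]) simp
    moreover have "\<exists>d. (x i + Suc n) mod l = (?a + d) mod l \<and> d < r"
      using assms by (intro exI[of _ 1]) (simp add: mod_simps One_nat_def)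
    ultimately have "?e \<in> edge_index l m \<and> ?y n \<in> hyperedge l m r ?e \<and> ?y (Suc n) \<in> hyperedge l m r ?e"
      by (auto simp: hyperedge_def)
    then have "(?y n, ?y (Suc n)) \<in> ?R" by blast
    with Suc show ?case by (rule rtrancl_into_rtrancl)
  qed
  \<comment> \<open>\<open>J\<close> collects the coordinates already moved to those of
    \<open>v\<close>.\<close>
  have "(u, \<lambda>j. if j \<in> J then v j else u j) \<in> ?R\<^sup>* \<and> (\<lambda>j. if j \<in> J then v j else u j) \<in> torus l m"
    if "finite J" "J \<subseteq> {1..m}" for J
    using that
  proof (induction J rule: finite_induct)
    case (insert i J)
    let ?w = "\<lambda>j. if j \<in> J then v j else u j"
    have i: "i \<in> {1..m}" and w: "?w \<in> torus l m" "(u, ?w) \<in> ?R\<^sup>*" using insert by auto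
    have "(?w i + (v i + (l - ?w i))) mod l = v i"
      using torus_lt[OF w(1) i] torus_lt[OF v i] by (simp add: add.left_commute)
    then have "?w(i := v i) \<in> torus l m" "(?w, ?w(i := v i)) \<in> ?R\<^sup>*"
      using torus_upd[OF w(1) i] torus_lt[OF v i] shift[OF w(1) i, of "v i + (l - ?w i)"] by auto
    moreover have "?w(i := v i) = (\<lambda>j. if j \<in> insert i J then v j else u j)" by auto
    ultimately show ?case using w(2) by (metis (no_types, lifting) rtrancl_trans)
  qed (use u in auto)
  from this[of "{1..m}"]
  have "(u, \<lambda>j. if j \<in> {1..m} then v j else u j) \<in> ?R\<^sup>*" "(\<lambda>j. if j \<in> {1..m} then v j else u j) \<in> torus l m"
    by simp_all
  moreover from this(2) have "(\<lambda>j. if j \<in> {1..m} then v j else u j) = v"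
    by (rule torus_eqI[OF _ v]) simp
  ultimately show "(u, v) \<in> ?R\<^sup>*" by simp
qed

section \<open>Matrices with an eigenbasis\<close>

text \<open>Makes a diagonalization a Jordan normal form with blocks of size 1, from which
  multiplicities can be read.\<close>

lemma jordan_matrix_diag:
  "jordan_matrix (map (Pair 1) as)
    = mat (length as) (length as) (\<lambda>(i, j). if i = j then as ! i else 0)"
proof (induction as)
  case Nil
  then show ?case by (intro eq_matI) (auto simp: jordan_matrix_def)
next
  case (Cons a as)
  have dims: "dim_row (jordan_matrix (map (Pair 1) as)) = length as"
    "dim_col (jordan_matrix (map (Pair 1) as)) = length as"
    by (simp_all add: Cons.IH)
  have "jordan_matrix (map (Pair 1) (a # as))
    = four_block_mat (jordan_block 1 a) (0\<^sub>m 1 (length as)) (0\<^sub>m (length as) 1)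
        (jordan_matrix (map (Pair 1) as))"
    using dims unfolding jordan_matrix_def by (simp add: Let_def)
  then show ?case
    unfolding Cons.IH by (intro eq_matI) (auto simp: nth_Cons')
qed

text \<open>The eigenvector columns give \<open>A * P = P * D\<close> with \<open>D\<close>
  diagonal, so \<open>A\<close> is similar to \<open>D\<close>.\<close>

lemma has_multiplicity_eigenbasis:
  fixes A :: "complex mat"
  assumes A: "A \<in> carrier_mat n n" and P: "P \<in> carrier_mat n n" and Q: "Q \<in> carrier_mat n n"
    and PQ: "P * Q = 1\<^sub>m n" and QP: "Q * P = 1\<^sub>m n"
    and ev: "\<And>j. j < n \<Longrightarrow> A *\<^sub>v col P j = f j \<cdot>\<^sub>v col P j"
  shows "has_multiplicity A c (card {j. j < n \<and> f j = c})"
proof -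
  let ?js = "map (Pair 1) (map f [0..<n])"
  define D where "D = jordan_matrix ?js"
  have D_eq: "D = mat n n (\<lambda>(i, j). if i = j then f i else 0)"
    unfolding D_def jordan_matrix_diag by (intro eq_matI) auto
  then have D: "D \<in> carrier_mat n n" by simp
  have AP: "A * P = P * D"
  proof (rule eq_matI)
    fix i j assume "i < dim_row (P * D)" "j < dim_col (P * D)"
    then have ij: "i < n" "j < n" using P D by auto
    have "(A * P) $$ (i, j) = (A *\<^sub>v col P j) $ i"
      using ij A P by simp
    also have "\<dots> = f j * P $$ (i, j)"
      using ij P by (simp add: ev)
    also have "\<dots> = (\<Sum>k<n. if k = j then f j * P $$ (i, j) else 0)"
      using ij by simp
    also have "\<dots> = (P * D) $$ (i, j)"
      using ij P by (simp add: D_eq scalar_prod_def atLeast0LessThan if_distrib mult.commute cong: if_cong)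
    finally show "(A * P) $$ (i, j) = (P * D) $$ (i, j)" .
  qed (use A P D in auto)
  have "A = A * (P * Q)" using A by (simp add: PQ)
  also have "\<dots> = P * D * Q" using A P Q by (simp add: AP flip: assoc_mult_mat)
  finally have "similar_mat_wit A D P Q"
    using A P Q D PQ QP by (auto simp: similar_mat_wit_def Let_def)
  then have jnf: "jordan_nf A ?js"
    by (auto simp: jordan_nf_def similar_mat_def D_def)
  have count: "length (filter (\<lambda>j. f j = c) [0..<n]) = card {j. j < n \<and> f j = c}"
    by (simp add: length_filter_conv_card cong: conj_cong)
  \<comment> \<open>Block sizes add up to the algebraic multiplicity, sizes capped at 1 to the
    geometric one. As all blocks have size 1, both count blocks.\<close>
  have "sum_list (map fst (filter (\<lambda>na. snd na = c) ?js)) = card {j. j < n \<and> f j = c}"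
    by (simp add: filter_map comp_def sum_list_triv flip: count)
  moreover have "(\<Sum>k\<leftarrow>map fst (filter (\<lambda>(k, e). e = c) ?js). min 1 k) = card {j. j < n \<and> f j = c}"
    by (simp add: filter_map comp_def sum_list_triv flip: count)
  moreover have "dim_gen_eigenspace A c 1 = kernel_dim (char_matrix A c)"
    using A by (simp add: dim_gen_eigenspace_def char_matrix_def One_nat_def)
  ultimately show ?thesis
    using jordan_nf_order[OF jnf, of c] dim_gen_eigenspace[OF jnf, of c 1]
    by (simp add: has_multiplicity_def)
qed

text \<open>The left inverse forces a nonzero determinant, hence independence; distinctness ensures
  that the set of columns has \<open>n\<close> elements, the dimension.\<close>

lemma basis_cols_invertible:
  fixes P :: "complex mat"
  assumes P: "P \<in> carrier_mat n n" and Q: "Q \<in> carrier_mat n n" and QP: "Q * P = 1\<^sub>m n"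
    and "distinct (cols P)"
  shows "vectorspace.basis class_ring (module_vec TYPE(complex) n) (set (cols P))"
proof -
  interpret vec_space "TYPE(complex)" n .
  have "det Q * det P = 1"
    using det_mult[OF Q P] QP by simp
  then have "lin_indpt (set (cols P))"
    using lin_dep_cols_imp_det_0[OF P] by auto
  moreover have "card (set (cols P)) = n"
    using P assms(4) by (simp add: distinct_card)
  moreover have "set (cols P) \<subseteq> carrier V"
    using cols_dim[of P] unfolding carrier_matD(1)[OF P] by simp
  ultimately show ?thesis
    by (intro dim_li_is_basis) (auto simp: dim_is_n)
qed

lemma smult_mat_mult_vec:
  assumes "A \<in> carrier_mat nr nc" and "v \<in> carrier_vec nc"
  shows "(b \<cdot>\<^sub>m A) *\<^sub>v v = b \<cdot>\<^sub>v (A *\<^sub>v (v :: 'a :: comm_ring_1 vec))"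
  by (rule eq_vecI) (use assms in \<open>auto simp: scalar_prod_def sum_distrib_left mult.assoc\<close>)

section \<open>Spectrum of the hyperlattice\<close>

lemma sum_nth_distinct:
  assumes "distinct xs" and "set xs = X"
  shows "(\<Sum>i<length xs. f (xs ! i)) = (\<Sum>x\<in>X. f x)"
  by (rule sum.reindex_bij_betw) (use assms in \<open>auto intro: bij_betw_nth\<close>)

lemma card_nth_distinct:
  assumes "distinct xs" and "set xs = X"
  shows "card {i. i < length xs \<and> p (xs ! i)} = card {x \<in> X. p x}"
proof (rule bij_betw_same_card)
  show "bij_betw ((!) xs) {i. i < length xs \<and> p (xs ! i)} {x \<in> X. p x}"
    using assms by (auto simp: bij_betw_def inj_on_nth in_set_conv_nth)
qed

locale hyperlattice =
  fixes l m r :: nat and vs :: "(nat \<Rightarrow> nat) list"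
  assumes l_pos: "0 < l" and r_ge_2: "2 \<le> r" and r_le_l: "r \<le> l"
    and distinct_vs: "distinct vs" and set_vs: "set vs = torus l m"
begin

abbreviation "n \<equiv> length vs"
abbreviation "F \<equiv> fourier_vec l m vs"
abbreviation "A \<equiv> clique_adj_mat l m r vs"
abbreviation "Lcl \<equiv> clique_laplacian l m r vs"
abbreviation "Lh \<equiv> hyperedge_laplacian l m r vs"

text \<open>The list \<open>vs\<close> serves twice: it enumerates points as rows and modes as
  columns.\<close>

definition P where "P = mat_of_cols n (map F vs)"
text \<open>The conjugate transpose of \<open>P\<close>, scaled to become its inverse.\<close>

definition Q where "Q = mat n n (\<lambda>(i, j). cnj (fourier l m (vs ! i) (vs ! j)) / of_nat (l ^ m))"

lemma nth_vs: "i < n \<Longrightarrow> vs ! i \<in> torus l m"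
  using set_vs nth_mem by blast

lemma F_carrier [simp]: "F k \<in> carrier_vec n"
  by (simp add: fourier_vec_def)

lemma A_carrier [simp]: "A \<in> carrier_mat n n"
  by (simp add: clique_adj_mat_def)

lemma P_carrier [simp]: "P \<in> carrier_mat n n"
  using mat_of_cols_carrier(1)[of n "map F vs"] by (simp add: P_def)

lemma Q_carrier [simp]: "Q \<in> carrier_mat n n"
  by (simp add: Q_def)

lemma col_P: "j < n \<Longrightarrow> col P j = F (vs ! j)"
  by (simp add: P_def)

lemma cols_P: "cols P = map F vs"
  unfolding P_def by (rule cols_mat_of_cols) auto

lemma P_index: "i < n \<Longrightarrow> j < n \<Longrightarrow> P $$ (i, j) = fourier l m (vs ! j) (vs ! i)"
  by (simp add: P_def mat_of_cols_index fourier_vec_def)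

lemma Q_index: "i < n \<Longrightarrow> j < n \<Longrightarrow> Q $$ (i, j) = cnj (fourier l m (vs ! i) (vs ! j)) / of_nat (l ^ m)"
  by (simp add: Q_def)

text \<open>In this order the inner index runs over modes, as in
  \<open>fourier_orthogonal\<close>.\<close>

lemma PQ: "P * Q = 1\<^sub>m n"
proof (rule eq_matI)
  fix i j assume "i < dim_row (1\<^sub>m n)" "j < dim_col (1\<^sub>m n)"
  then have ij: "i < n" "j < n" by auto
  have "(P * Q) $$ (i, j)
      = (\<Sum>k<n. fourier l m (vs ! k) (vs ! i) * cnj (fourier l m (vs ! k) (vs ! j))) / of_nat (l ^ m)"
    using ij carrier_matD[OF P_carrier] carrier_matD[OF Q_carrier]
    by (simp add: scalar_prod_def atLeast0LessThan P_index Q_index sum_divide_distrib)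
  also have "\<dots> = (if vs ! i = vs ! j then 1 else 0)"
    using l_pos fourier_orthogonal[OF nth_vs nth_vs, OF ij]
    unfolding sum_nth_distinct[OF distinct_vs set_vs,
        of "\<lambda>k. fourier l m k (vs ! i) * cnj (fourier l m k (vs ! j))"]
    by (simp only:) simp
  also have "\<dots> = 1\<^sub>m n $$ (i, j)"
    using ij distinct_vs by (simp add: nth_eq_iff_index_eq)
  finally show "(P * Q) $$ (i, j) = 1\<^sub>m n $$ (i, j)" .
qed (use carrier_matD[OF P_carrier] carrier_matD[OF Q_carrier] in auto)

lemma QP: "Q * P = 1\<^sub>m n"
  using mat_mult_left_right_inverse[OF P_carrier Q_carrier PQ] .

text \<open>By the symmetry of \<open>fourier\<close> in mode and point, equal vectors for distinct
  \<open>x\<close>, \<open>y\<close> would equate the orthogonality sums 0 and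
  \<open>l ^ m\<close>.\<close>

lemma inj_on_F: "inj_on F (torus l m)"
proof (rule inj_onI, rule ccontr)
  fix x y assume xy: "x \<in> torus l m" "y \<in> torus l m" "F x = F y" "x \<noteq> y"
  have "fourier l m v x = fourier l m v y" if "v \<in> torus l m" for v
  proof -
    from that obtain i where i: "i < n" "vs ! i = v"
      unfolding set_vs[symmetric] in_set_conv_nth by blast
    have "F x $ i = F y $ i" by (simp only: xy(3))
    then have "fourier l m x v = fourier l m y v"
      unfolding fourier_vec_def index_vec[OF i(1)] i(2) .
    then show ?thesis
      unfolding fourier_commute[of l m v x] fourier_commute[of l m v y] .
  qed
  then have "(\<Sum>k\<in>torus l m. fourier l m k x * cnj (fourier l m k y))
      = (\<Sum>k\<in>torus l m. fourier l m k x * cnj (fourier l m k x))"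
    by (intro sum.cong refl) simp
  then have "of_nat (l ^ m) = (0 :: complex)"
    unfolding fourier_orthogonal[OF xy(1,2)] fourier_orthogonal[OF xy(1,1)] using xy(4) by simp
  then show False using l_pos by simp
qed

lemma basis_F: "vectorspace.basis class_ring (module_vec TYPE(complex) n) (F ` torus l m)"
proof -
  have "distinct (cols P)"
    unfolding cols_P distinct_map set_vs using distinct_vs inj_on_F by blast
  from basis_cols_invertible[OF P_carrier Q_carrier QP this] show ?thesis
    by (simp add: cols_P set_vs)
qed

section \<open>Eigenvalue equations and multiplicities\<close>

lemma A_mult_F: "A *\<^sub>v F k = of_real (alpha l m r k) \<cdot>\<^sub>v F k"
proof (rule eq_vecI)
  fix i assume "i < dim_vec (complex_of_real (alpha l m r k) \<cdot>\<^sub>v F k)"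
  then have i: "i < n" by (simp add: fourier_vec_def)
  then have "(A *\<^sub>v F k) $ i
      = (\<Sum>j<n. of_nat (lattice_adj l m r (vs ! i) (vs ! j)) * fourier l m k (vs ! j))"
    by (simp add: clique_adj_mat_def fourier_vec_def scalar_prod_def atLeast0LessThan)
  also have "\<dots> = of_real (alpha l m r k) * fourier l m k (vs ! i)"
    unfolding sum_nth_distinct[OF distinct_vs set_vs, of "\<lambda>v. of_nat (lattice_adj l m r (vs ! i) v) * fourier l m k v"]
    by (rule sum_lattice_adj_fourier[OF nth_vs[OF i] r_le_l l_pos])
  also have "\<dots> = (of_real (alpha l m r k) \<cdot>\<^sub>v F k) $ i"
    using i by (simp add: fourier_vec_def)
  finally show "(A *\<^sub>v F k) $ i = (of_real (alpha l m r k) \<cdot>\<^sub>v F k) $ i" .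
qed (simp add: clique_adj_mat_def fourier_vec_def)

text \<open>Covers both Laplacians at once, with \<open>b = 1\<close> and
  \<open>b = 1 / (r - 1)\<close>.\<close>

lemma affine_mult_F:
  "(a \<cdot>\<^sub>m 1\<^sub>m n - b \<cdot>\<^sub>m A) *\<^sub>v F k = (a - b * of_real (alpha l m r k)) \<cdot>\<^sub>v F k"
proof -
  have "(a \<cdot>\<^sub>m 1\<^sub>m n - b \<cdot>\<^sub>m A) *\<^sub>v F k = (a \<cdot>\<^sub>m 1\<^sub>m n) *\<^sub>v F k - (b \<cdot>\<^sub>m A) *\<^sub>v F k"
    by (rule minus_mult_distrib_mat_vec) auto
  also have "\<dots> = a \<cdot>\<^sub>v F k - b \<cdot>\<^sub>v (A *\<^sub>v F k)"
    by (simp add: smult_mat_mult_vec[of _ n n])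
  also have "\<dots> = (a - b * of_real (alpha l m r k)) \<cdot>\<^sub>v F k"
    by (intro eq_vecI) (auto simp: A_mult_F algebra_simps)
  finally show ?thesis .
qed

lemma one_smult_A: "1 \<cdot>\<^sub>m A = A"
  by (intro eq_matI) auto

lemma Lcl_mult_F: "Lcl *\<^sub>v F k = of_real (lambda_cl l m r k) \<cdot>\<^sub>v F k"
  using affine_mult_F[of "of_nat m * of_nat r * (of_nat r - 1)" 1 k]
  by (simp add: clique_laplacian_def lambda_cl_def one_smult_A)

lemma Lh_mult_F: "Lh *\<^sub>v F k = of_real (lambda_h l m r k) \<cdot>\<^sub>v F k"
  using affine_mult_F[of "of_nat m * of_nat r" "1 / (of_nat r - 1)" k]
  by (simp add: hyperedge_laplacian_def lambda_h_def)

lemma Lcl_carrier [simp]: "Lcl \<in> carrier_mat n n"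
  by (simp add: clique_laplacian_def minus_carrier_mat)

lemma Lh_carrier [simp]: "Lh \<in> carrier_mat n n"
  by (simp add: hyperedge_laplacian_def minus_carrier_mat)

lemma F_neq_0: "F k \<noteq> 0\<^sub>v n"
proof
  assume "F k = 0\<^sub>v n"
  moreover have "0 < n"
    using zero_in_torus[OF l_pos, of m] set_vs by (cases vs) auto
  ultimately have "fourier l m k (vs ! 0) = 0"
    by (metis fourier_vec_def index_vec index_zero_vec(1))
  then show False by (simp add: fourier_neq_0)
qed

lemma eigenvector_F:
  assumes "M \<in> carrier_mat n n" and "M *\<^sub>v F k = c \<cdot>\<^sub>v F k"
  shows "eigenvector M (F k) c"
  using assms F_neq_0 by (auto simp: eigenvector_def)

lemma multiplicity_F:
  fixes f :: "(nat \<Rightarrow> nat) \<Rightarrow> real"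
  assumes "M \<in> carrier_mat n n" and "\<And>k. M *\<^sub>v F k = of_real (f k) \<cdot>\<^sub>v F k"
  shows "has_multiplicity M (of_real c) (card {k \<in> torus l m. f k = c})"
  using has_multiplicity_eigenbasis[OF assms(1) P_carrier Q_carrier PQ QP, of "\<lambda>j. of_real (f (vs ! j))" "of_real c"]
    card_nth_distinct[OF distinct_vs set_vs, of "\<lambda>k. f k = c"]
  by (simp add: col_P assms(2))

lemma lambda_cl_eq_0_iff:
  "k \<in> torus l m \<Longrightarrow> lambda_cl l m r k = 0 \<longleftrightarrow> k = (\<lambda>j\<in>{1..m}. 0)"
  using alpha_eq_max_iff[OF r_ge_2, of k l m] by (auto simp: lambda_cl_def)

lemma lambda_h_eq_0_iff:
  "k \<in> torus l m \<Longrightarrow> lambda_h l m r k = 0 \<longleftrightarrow> k = (\<lambda>j\<in>{1..m}. 0)"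
proof -
  \<comment> \<open>The two spectra are proportional, so their zeros coincide.\<close>
  have "lambda_h l m r k = lambda_cl l m r k / (real r - 1)"
    using r_ge_2 by (simp add: lambda_h_def lambda_cl_def field_simps)
  then show "k \<in> torus l m \<Longrightarrow> ?thesis"
    using lambda_cl_eq_0_iff[of k] r_ge_2 by simp
qed

end

theorem theorem6p1:
  fixes l m r :: nat and vs :: "(nat \<Rightarrow> nat) list"
  assumes "2 \<le> l" and "1 \<le> m" and "2 \<le> r" and "r \<le> l"
    and "distinct vs" and "set vs = torus l m"
  shows
    "(\<comment> \<open>(1)\<close>
      (\<exists>g. \<forall>x\<in>torus l m. \<forall>y\<in>torus l m. lattice_adj l m r x y = g (torus_diff l m x y)) \<and>
      inj_on (fourier_vec l m vs) (torus l m) \<and>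
      vectorspace.basis class_ring (module_vec TYPE(complex) (length vs))
        (fourier_vec l m vs ` torus l m) \<and>
      (\<forall>k\<in>torus l m.
        eigenvector (clique_adj_mat l m r vs) (fourier_vec l m vs k) (of_real (alpha l m r k))) \<and>
      alpha1D l r 0 = real r * (real r - 1)) \<and>
     (\<comment> \<open>(2)\<close>
      \<forall>k\<in>torus l m.
        eigenvector (clique_laplacian l m r vs) (fourier_vec l m vs k)
          (of_real (lambda_cl l m r k)) \<and>
        eigenvector (hyperedge_laplacian l m r vs) (fourier_vec l m vs k)
          (of_real (lambda_h l m r k))) \<and>
     (\<comment> \<open>(3)\<close>
      \<forall>k\<in>torus l m.
        has_multiplicity (clique_laplacian l m r vs) (of_real (lambda_cl l m r k))
          (card {k' \<in> torus l m. alpha l m r k' = alpha l m r k})) \<and>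
     (\<comment> \<open>(4)\<close>
      lambda_cl l m r (\<lambda>j\<in>{1..m}. 0) = 0 \<and>
      lambda_h l m r (\<lambda>j\<in>{1..m}. 0) = 0 \<and>
      has_multiplicity (clique_laplacian l m r vs) 0 1 \<and>
      has_multiplicity (hyperedge_laplacian l m r vs) 0 1 \<and>
      hypergraph_connected (torus l m) (edge_index l m) (hyperedge l m r))"
proof -
  interpret hyperlattice l m r vs
    using assms by unfold_locales auto
  let ?o = "\<lambda>j\<in>{1..m}. 0 :: nat"
  have o: "?o \<in> torus l m" by (rule zero_in_torus[OF l_pos])
  have "{k \<in> torus l m. lambda_cl l m r k = 0} = {?o}" "{k \<in> torus l m. lambda_h l m r k = 0} = {?o}"
    using o lambda_cl_eq_0_iff lambda_h_eq_0_iff by blast+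
  then have mult0: "has_multiplicity Lcl 0 1" "has_multiplicity Lh 0 1"
    using multiplicity_F[OF Lcl_carrier Lcl_mult_F, of 0] multiplicity_F[OF Lh_carrier Lh_mult_F, of 0]
    by (simp_all add: One_nat_def)
  \<comment> \<open>Since \<open>lambda_cl\<close> is a constant minus \<open>alpha\<close>, the two
    have the same level sets.\<close>
  have mult: "has_multiplicity Lcl (of_real (lambda_cl l m r k))
      (card {k' \<in> torus l m. alpha l m r k' = alpha l m r k})" for k
    using multiplicity_F[OF Lcl_carrier Lcl_mult_F, of "lambda_cl l m r k"]
    by (simp add: lambda_cl_def)
  show ?thesis
    using lattice_adj_circulant[OF r_le_l l_pos] inj_on_F basis_F alpha1D_0 mult mult0
      eigenvector_F[OF A_carrier A_mult_F] eigenvector_F[OF Lcl_carrier Lcl_mult_F]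
      eigenvector_F[OF Lh_carrier Lh_mult_F] lambda_cl_eq_0_iff[OF o] lambda_h_eq_0_iff[OF o]
      hyperlattice_connected[OF r_ge_2 r_le_l]
    by (intro conjI ballI) blast+
qed

end
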